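(* Let $(\Omega,\mathcal{A},\mu)$ be a probability space and $\mathcal{I}\subseteq\mathcal{A}$ a system of measurable sets with $\omega_{\mathrm{frac}}(\mathcal{I})=\chi_{\mathrm{frac}}(\mathcal{I})$. Then $\sup_\pi H(\mathcal{I},\pi)=\log\chi_{\mathrm{frac}}(\mathcal{I})$, the supremum being over probability measures $\pi\ll\mu$, in the sense that for every $0<\lambda<1$, \[ \sup_{\pi\ll\mu}\underline{H}_\lambda(\mathcal{I},\pi)=\sup_{\pi\ll\mu}\overline{H}_\lambda(\mathcal{I},\pi)=\log\chi_{\mathrm{frac}}(\mathcal{I}). \]
   Context: For a probability measure $\pi$: an $\ell$-dimensional $\mathcal{I}$-box is $J_1\times\cdots\times J_\ell$ with $J_i\in\mathcal{I}$; $N_\ell(\mathcal{I},\pi,\lambda)$ is the minimum number of such boxes whose union has $\pi^\ell$-measure at least $1-\lambda$; $\underline{H}_\lambda(\mathcal{I},\pi)=\liminf_\ell\frac1\ell\log N_\ell(\mathcal{I},\pi,\lambda)$ and $\overline{H}_\lambda(\mathcal{I},\pi)=\limsup_\ell\frac1\ell\log N_\ell(\mathcal{I},\pi,\lambda)$; $H(\mathcal{I},\pi)$ denotes their common value when they agree for all $\lambda$. The fractional chromatic number is $\chi_{\mathrm{frac}}(\mathcal{I})=\inf\{\sum_{J\in\mathcal{I}}c(J): c:\mathcal{I}\to[0,1],\ \sum_{J\ni x}c(J)\ge1\text{ for }\mu\text{-a.e. }x\}$, and the fractional clique number is $\omega_{\mathrm{frac}}(\mathcal{I})=\sup\{\int_\Omega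 b\,\mathrm{d}\mu: b:\Omega\to[0,1]\text{ measurable},\ \int_Jb\,\mathrm{d}\mu\le1\ \forall J\in\mathcal{I}\}$. *)

theory Defs
  imports "HOL-Probability.Probability"
begin

definition boxes :: "nat \<Rightarrow> 'a set set \<Rightarrow> (nat \<Rightarrow> 'a) set set" where
  "boxes l I = {(\<Pi>\<^sub>E i\<in>{..<l}. J i) | J. J \<in> {..<l} \<rightarrow> I}"

(* The value is \<infinity> if no finite family of boxes has a union of the required measure. *)
definition box_number :: "nat \<Rightarrow> 'a set set \<Rightarrow> 'a measure \<Rightarrow> real \<Rightarrow> enat" where
  "box_number l I P lam =
     Inf {enat (card B) | B. finite B \<and> B \<subseteq> boxes l I \<and>
            1 - lam \<le> measure (Pi\<^sub>M {..<l} (\<lambda>_. P)) (\<Union>B)}"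

(* Natural logarithm with values in the extended reals: log 0 = -\<infinity> and log \<infinity> = \<infinity>. *)
definition elog :: "ennreal \<Rightarrow> ereal" where
  "elog x = (if x = 0 then -\<infinity> else if x = \<infinity> then \<infinity> else ereal (ln (enn2real x)))"

definition H_lower :: "real \<Rightarrow> 'a set set \<Rightarrow> 'a measure \<Rightarrow> ereal" where
  "H_lower lam I P =
     liminf (\<lambda>l. ereal (1 / real l) * elog (ennreal_of_enat (box_number l I P lam)))"

definition H_upper :: "real \<Rightarrow> 'a set set \<Rightarrow> 'a measure \<Rightarrow> ereal" where
  "H_upper lam I P =
     limsup (\<lambda>l. ereal (1 / real l) * elog (ennreal_of_enat (box_number l I P lam)))"

(* I may be uncountable; the sums are unordered sums of nonnegative terms, with values in [0,\<infinity>].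
   The value is \<infinity> if there is no fractional colouring. *)
definition frac_chromatic_number :: "'a measure \<Rightarrow> 'a set set \<Rightarrow> ennreal" where
  "frac_chromatic_number M I =
     Inf {(\<Sum>\<^sub>\<infinity>J\<in>I. ennreal (c J)) | c :: 'a set \<Rightarrow> real.
            c \<in> I \<rightarrow> {0..1} \<and> (AE x in M. 1 \<le> (\<Sum>\<^sub>\<infinity>J\<in>{J\<in>I. x \<in> J}. ennreal (c J)))}"

(* R is the set of admissible values of the weight b. For R = {0..1} and a probability measure M
   the value is always 1 (attained by b = 1). The normalisation under which finite graphs with the
   uniform measure get their usual fractional clique number is R = {0..}: there b is a density
   with respect to M and can exceed 1. *)
definition frac_clique_number :: "real set \<Rightarrow> 'a measure \<Rightarrow> 'a set set \<Rightarrow> ennreal" where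
  "frac_clique_number R M I =
     Sup {(\<integral>\<^sup>+x. ennreal (b x) \<partial>M) | b :: 'a \<Rightarrow> real.
            b \<in> borel_measurable M \<and> b \<in> space M \<rightarrow> R \<and>
            (\<forall>J\<in>I. (\<integral>\<^sup>+x\<in>J. ennreal (b x) \<partial>M) \<le> 1)}"

definition ac_prob_measures :: "'a measure \<Rightarrow> 'a measure set" where
  "ac_prob_measures M = {P. prob_space P \<and> sets P = sets M \<and> absolutely_continuous M P}"

end

theory Submission
  imports Defs
begin

text \<open>Lower bound: after normalising a fractional clique of weight \<open>W\<close> to a probability density,
  every \<open>l\<close>-dimensional box has measure at most \<open>1 / W ^ l\<close>, so \<open>(1 - lam) * W ^ l\<close> boxes are
  needed. Upper bound: given a fractional colouring of weight less than \<open>s\<close>, some box always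
  covers a fraction \<open>1 / s ^ l\<close> of what is still uncovered, so greedily chosen
  \<open>s ^ l * ln (1 / lam)\<close> boxes suffice.\<close>

section \<open>The logarithm with extended real values\<close>

text \<open>The values of \<open>elog\<close> at 0 and at infinity make the equivalence hold without
  side conditions. Density of the reals then lets a bound on \<open>elog x\<close> be checked
  against real numbers only.\<close>

lemma ereal_less_elog_iff: "ereal r < elog x \<longleftrightarrow> ennreal (exp r) < x"
proof (cases x)
  case (real y)
  then show ?thesis
  proof (cases "y = 0")
    case False
    with real have "y > 0" by simp
    with real have "elog x = ereal (ln y)"
      by (simp add: elog_def)
    with real \<open>y > 0\<close> show ?thesis
      by (simp add: ennreal_less_iff) (metis exp_less_cancel_iff exp_ln)
  qed (simp add: elog_def)
qed (simp add: elog_def)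

lemma elog_less_ereal_iff: "elog x < ereal r \<longleftrightarrow> x < ennreal (exp r)"
proof (cases x)
  case (real y)
  then show ?thesis
  proof (cases "y = 0")
    case False
    with real have "y > 0" by simp
    with real have "elog x = ereal (ln y)"
      by (simp add: elog_def)
    with real \<open>y > 0\<close> show ?thesis
      by (simp add: ennreal_less_iff) (metis exp_less_cancel_iff exp_ln)
  qed (simp add: elog_def)
qed (simp add: elog_def)

lemma elog_mono:
  assumes "x \<le> y" shows "elog x \<le> elog y"
proof (rule dense_le)
  fix z assume z: "z < elog x"
  show "z \<le> elog y"
  proof (cases z)
    case (real r)
    with z assms show ?thesis
      by (metis ereal_less_elog_iff less_imp_le order_less_le_trans)
  qed (use z in auto)
qed

lemma elog_ennreal: "0 < y \<Longrightarrow> elog (ennreal y) = ereal (ln y)"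
  by (simp add: elog_def)

section \<open>Boxes in the product space\<close>

lemma prod_mono_ennreal:
  fixes f g :: "'b \<Rightarrow> ennreal"
  assumes "\<And>i. i \<in> A \<Longrightarrow> f i \<le> g i"
  shows "prod f A \<le> prod g A"
  using assms by (induction A rule: infinite_finite_induct) (auto intro: mult_mono)

lemma boxes_subset_sets_PiM:
  assumes "I \<subseteq> sets P"
  shows "boxes l I \<subseteq> sets (Pi\<^sub>M {..<l} (\<lambda>_. P))"
  using assms by (force simp: boxes_def intro!: sets_PiM_I_finite)

lemma emeasure_box:
  fixes l :: nat
  assumes "prob_space P" "J \<in> {..<l} \<rightarrow> sets P"
  shows "emeasure (Pi\<^sub>M {..<l} (\<lambda>_. P)) (\<Pi>\<^sub>E i\<in>{..<l}. J i) = (\<Prod>i<l. emeasure P (J i))"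
proof -
  interpret prob_space P by fact
  interpret product_sigma_finite "\<lambda>_::nat. P" ..
  show ?thesis
    using assms(2) by (intro emeasure_PiM) auto
qed

section \<open>The lower bound from fractional cliques\<close>

text \<open>Each box has measure at most \<open>(1 / W) ^ l\<close> by independence, so the union
  bound forces a family of measure \<open>1 - lam\<close> to be large. An infinite box number
  satisfies the bound trivially.\<close>

lemma box_number_ge:
  fixes W :: real
  assumes "prob_space P" "I \<subseteq> sets P" "0 < W"
    and small: "\<And>J. J \<in> I \<Longrightarrow> emeasure P J \<le> ennreal (1 / W)"
  shows "ennreal ((1 - lam) * W ^ l) \<le> ennreal_of_enat (box_number l I P lam)"
proof (cases "box_number l I P lam")
  case (enat n)
  let ?S = "{enat (card B) | B. finite B \<and> B \<subseteq> boxes l I \<and>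
            1 - lam \<le> measure (Pi\<^sub>M {..<l} (\<lambda>_. P)) (\<Union>B)}"
  \<comment> \<open>A finite value excludes the empty set, whose infimum is infinity, and
    well-ordering of \<open>enat\<close> then gives a family that attains the infimum.\<close>
  have "?S \<noteq> {}"
    using enat unfolding box_number_def by (metis (no_types, lifting) Inf_enat_def enat.distinct(2) infinity_enat_def)
  then have "Inf ?S \<in> ?S"
    by (meson ex_in_conv wellorder_InfI)
  then obtain B where B: "finite B" "B \<subseteq> boxes l I" "card B = n"
      "1 - lam \<le> measure (Pi\<^sub>M {..<l} (\<lambda>_. P)) (\<Union>B)"
    using enat unfolding box_number_def by auto
  let ?Q = "Pi\<^sub>M {..<l} (\<lambda>_. P)"
  interpret Q: prob_space ?Q
    using assms(1) by (rule prob_space_PiM)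
  have box: "measure ?Q b \<le> (1 / W) ^ l" if "b \<in> boxes l I" for b
  proof -
    from that obtain J where J: "b = (\<Pi>\<^sub>E i\<in>{..<l}. J i)" "J \<in> {..<l} \<rightarrow> I"
      unfolding boxes_def by auto
    have "emeasure ?Q b = (\<Prod>i<l. emeasure P (J i))"
      unfolding J(1) using J(2) assms(2) by (intro emeasure_box assms(1)) auto
    also have "\<dots> \<le> (\<Prod>i<l. ennreal (1 / W))"
      using J(2) by (intro prod_mono_ennreal) (auto intro!: small)
    also have "\<dots> = ennreal ((1 / W) ^ l)"
      using assms(3) by (simp add: ennreal_power)
    finally show ?thesis
      using assms(3) by (simp add: Q.emeasure_eq_measure)
  qed
  have "1 - lam \<le> measure ?Q (\<Union>b\<in>B. b)"
    using B(4) by simp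
  also have "\<dots> \<le> (\<Sum>b\<in>B. measure ?Q b)"
    using B(1,2) boxes_subset_sets_PiM[OF assms(2)]
    by (intro Q.finite_measure_subadditive_finite) auto
  also have "\<dots> \<le> (\<Sum>b\<in>B. (1 / W) ^ l)"
    using B(2) box by (intro sum_mono) auto
  finally have "1 - lam \<le> real n / W ^ l"
    using B(3) by (simp add: power_one_over field_simps)
  then have "(1 - lam) * W ^ l \<le> real n"
    using assms(3) by (simp add: field_simps)
  then show ?thesis
    unfolding enat by (simp add: ennreal_of_nat_eq_real_of_nat ennreal_leI)
qed simp

text \<open>The factor \<open>1 - lam\<close> in the bound on the box number does not depend on
  \<open>l\<close>, so it vanishes in the exponential rate.\<close>

lemma ln_le_H_lower:
  fixes W :: real
  assumes "prob_space P" "I \<subseteq> sets P" "0 < W" "lam < 1"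
    and small: "\<And>J. J \<in> I \<Longrightarrow> emeasure P J \<le> ennreal (1 / W)"
  shows "ereal (ln W) \<le> H_lower lam I P"
proof -
  let ?f = "\<lambda>l. ln W + ln (1 - lam) * inverse (real l)"
  have "?f \<longlonglongrightarrow> ln W + ln (1 - lam) * 0"
    by (intro tendsto_intros lim_inverse_n)
  then have "(\<lambda>l. ereal (?f l)) \<longlonglongrightarrow> ereal (ln W)"
    by simp
  then have "ereal (ln W) = liminf (\<lambda>l. ereal (?f l))"
    by (intro lim_imp_Liminf[symmetric] sequentially_bot)
  also have "\<dots> \<le> H_lower lam I P"
    unfolding H_lower_def
  \<comment> \<open>The index \<open>l = 0\<close> is left out: there \<open>1 / real l\<close> is
    0.\<close>
  proof (rule Liminf_mono, rule eventually_sequentiallyI[of 1])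
    fix l :: nat assume "1 \<le> l"
    have "ereal (?f l) = ereal (1 / real l * (ln (1 - lam) + real l * ln W))"
      using \<open>1 \<le> l\<close> by (simp add: field_simps)
    also have "ln (1 - lam) + real l * ln W = ln ((1 - lam) * W ^ l)"
      using assms(3,4) by (subst ln_mult) (auto simp: ln_realpow)
    also have "ereal (1 / real l * ln ((1 - lam) * W ^ l)) =
        ereal (1 / real l) * elog (ennreal ((1 - lam) * W ^ l))"
      using assms(3,4) by (subst elog_ennreal) auto
    also have "\<dots> \<le> ereal (1 / real l) * elog (ennreal_of_enat (box_number l I P lam))"
      by (intro ereal_mult_left_mono elog_mono box_number_ge assms) auto
    finally show "ereal (?f l) \<le> \<dots>" .
  qed
  finally show ?thesis .
qed

text \<open>Truncating the weight \<open>b\<close> handles the case of an infinite integral.\<close>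

lemma elog_frac_clique_number_le:
  assumes "prob_space M" "I \<subseteq> sets M" "lam < 1"
  shows "elog (frac_clique_number R M I) \<le> (SUP P\<in>ac_prob_measures M. H_lower lam I P)"
proof (rule dense_le)
  fix z assume z: "z < elog (frac_clique_number R M I)"
  show "z \<le> (SUP P\<in>ac_prob_measures M. H_lower lam I P)"
  proof (cases z)
    case (real r)
    with z have "ennreal (exp r) < frac_clique_number R M I"
      by (simp add: ereal_less_elog_iff)
    then obtain b :: "'a \<Rightarrow> real" where b [measurable]: "b \<in> borel_measurable M"
      and bI: "\<And>J. J \<in> I \<Longrightarrow> (\<integral>\<^sup>+x\<in>J. ennreal (b x) \<partial>M) \<le> 1"
      and b_gt: "ennreal (exp r) < (\<integral>\<^sup>+x. ennreal (b x) \<partial>M)"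
      unfolding frac_clique_number_def less_Sup_iff by auto
    note b_gt
    also have "(\<integral>\<^sup>+x. ennreal (b x) \<partial>M) = (\<integral>\<^sup>+x. (SUP n::nat. ennreal (min (b x) (real n))) \<partial>M)"
    proof (intro nn_integral_cong antisym)
      fix x
      obtain n :: nat where "b x \<le> real n"
        using real_arch_simple by blast
      then show "ennreal (b x) \<le> (SUP n::nat. ennreal (min (b x) (real n)))"
        by (intro SUP_upper2[of n]) (auto simp: min_def)
    qed (auto intro!: SUP_least ennreal_leI)
    also have "\<dots> = (SUP n::nat. \<integral>\<^sup>+x. ennreal (min (b x) (real n)) \<partial>M)"
      by (intro nn_integral_monotone_convergence_SUP)
         (auto simp: incseq_def le_fun_def intro!: ennreal_leI)
    finally obtain n :: nat where n: "ennreal (exp r) < (\<integral>\<^sup>+x. ennreal (min (b x) (real n)) \<partial>M)"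
      by (auto simp: less_SUP_iff)
    \<comment> \<open>The truncated weight is bounded on a probability space, so its integral
      \<open>W\<close> is finite; it also exceeds \<open>exp r\<close>, so it can be
      normalised.\<close>
    define f where "f x = ennreal (min (b x) (real n))" for x
    have f [measurable]: "f \<in> borel_measurable M"
      unfolding f_def by measurable
    interpret M: prob_space M by fact
    have "(\<integral>\<^sup>+x. f x \<partial>M) \<le> (\<integral>\<^sup>+x. ennreal (real n) \<partial>M)"
      unfolding f_def by (intro nn_integral_mono ennreal_leI) auto
    then have "(\<integral>\<^sup>+x. f x \<partial>M) < \<infinity>"
      by (simp add: M.emeasure_space_1 order_le_less_trans)
    then obtain W where W: "(\<integral>\<^sup>+x. f x \<partial>M) = ennreal W" "0 \<le> W"
      by (cases "\<integral>\<^sup>+x. f x \<partial>M") auto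
    from n W have W_gt: "exp r < W"
      by (simp add: f_def[symmetric] ennreal_less_iff)
    then have "0 < W"
      by (meson exp_gt_zero order_less_trans)
    \<comment> \<open>The clique condition bounds the integral of \<open>f\<close> over each
      \<open>J\<close> in \<open>I\<close> by 1, hence this density gives every such
      \<open>J\<close> measure at most \<open>1 / W\<close>.\<close>
    define P where "P = density M (\<lambda>x. f x / ennreal W)"
    have P_eq: "emeasure P A = (\<integral>\<^sup>+x\<in>A. f x \<partial>M) / ennreal W" if [measurable]: "A \<in> sets M" for A
    proof -
      have "emeasure P A = (\<integral>\<^sup>+x. (f x * indicator A x) / ennreal W \<partial>M)"
        unfolding P_def using that
        by (simp add: emeasure_density divide_ennreal_def mult_ac)
      also have "\<dots> = (\<integral>\<^sup>+x\<in>A. f x \<partial>M) / ennreal W"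
        by (intro nn_integral_divide) measurable
      finally show ?thesis .
    qed
    have "prob_space P"
    proof
      have "emeasure P (space M) = ennreal W / ennreal W"
        by (subst P_eq) (auto simp: W(1)[symmetric] intro!: arg_cong2[where f = "(/)"] nn_integral_cong)
      then show "emeasure P (space P) = 1"
        using \<open>0 < W\<close> by (simp add: P_def divide_ennreal)
    qed
    moreover have setsP: "sets P = sets M"
      by (simp add: P_def)
    moreover have "absolutely_continuous M P"
      unfolding P_def by (intro absolutely_continuousI_density) measurable
    ultimately have P: "P \<in> ac_prob_measures M"
      by (simp add: ac_prob_measures_def)
    have small: "emeasure P J \<le> ennreal (1 / W)" if "J \<in> I" for J
    proof -
      have "(\<integral>\<^sup>+x\<in>J. f x \<partial>M) \<le> (\<integral>\<^sup>+x\<in>J. ennreal (b x) \<partial>M)"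
        unfolding f_def by (intro nn_integral_mono mult_right_mono ennreal_leI) auto
      also have "\<dots> \<le> 1"
        by (rule bI[OF that])
      finally have "(\<integral>\<^sup>+x\<in>J. f x \<partial>M) / ennreal W \<le> 1 / ennreal W"
        by (rule divide_right_mono_ennreal)
      also have "\<dots> = ennreal (1 / W)"
        using \<open>0 < W\<close> by (simp add: divide_ennreal flip: ennreal_1)
      finally show ?thesis
        using that assms(2) by (subst P_eq) auto
    qed
    have "ereal r \<le> ereal (ln W)"
      using W_gt \<open>0 < W\<close> by (simp add: ln_ge_iff)
    also have "\<dots> \<le> H_lower lam I P"
      using small assms \<open>0 < W\<close> \<open>prob_space P\<close> setsP by (intro ln_le_H_lower) auto
    also have "\<dots> \<le> (SUP P\<in>ac_prob_measures M. H_lower lam I P)"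
      using P by (rule SUP_upper)
    finally show ?thesis
      using real by simp
  qed (use z in auto)
qed

lemma H_lower_le_H_upper: "H_lower lam I P \<le> H_upper lam I P"
  unfolding H_lower_def H_upper_def by (intro Liminf_le_Limsup) simp

section \<open>Unordered sums as integrals over counting measure\<close>

lemma sum_le_nn_integral_count_space:
  fixes f :: "'b \<Rightarrow> ennreal"
  assumes "finite F" "F \<subseteq> A"
  shows "sum f F \<le> (\<integral>\<^sup>+x. f x \<partial>count_space A)"
proof -
  have "sum f F = (\<integral>\<^sup>+x. f x \<partial>count_space F)"
    using assms(1) by (simp add: nn_integral_count_space_finite)
  also have "\<dots> = (\<integral>\<^sup>+x. f x * indicator F x \<partial>count_space A)"
    using assms(2) by (subst (1 2) nn_integral_count_space_indicator)
      (auto intro!: nn_integral_cong split: split_indicator)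
  also have "\<dots> \<le> (\<integral>\<^sup>+x. f x \<partial>count_space A)"
    by (intro nn_integral_mono) (auto split: split_indicator)
  finally show ?thesis .
qed

text \<open>Every finite partial sum is below the integral. Passing to integrals makes Fubini
  available for fractional colourings.\<close>

lemma infsum_le_nn_integral_count_space:
  fixes f :: "'b \<Rightarrow> ennreal"
  shows "infsum f A \<le> (\<integral>\<^sup>+x. f x \<partial>count_space A)"
  by (intro infsum_le_finite_sums sum_le_nn_integral_count_space nonneg_summable_on_complete) simp_all

text \<open>A finite total bounds the real partial sums, so the family is absolutely summable and
  its integral over counting measure is its real sum. Summability will also give countable
  support.\<close>

lemma summable_on_ennreal_infsum_finite:
  fixes c :: "'b \<Rightarrow> real"
  assumes nonneg: "\<And>x. x \<in> A \<Longrightarrow> 0 \<le> c x" and fin: "(\<Sum>\<^sub>\<infinity>x\<in>A. ennreal (c x)) < \<infinity>"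
  shows "c summable_on A"
    and "(\<integral>\<^sup>+x. ennreal (c x) \<partial>count_space A) \<le> (\<Sum>\<^sub>\<infinity>x\<in>A. ennreal (c x))"
proof -
  obtain S where S: "(\<Sum>\<^sub>\<infinity>x\<in>A. ennreal (c x)) = ennreal S" "0 \<le> S"
    using fin by (cases "\<Sum>\<^sub>\<infinity>x\<in>A. ennreal (c x)") auto
  have le: "sum c F \<le> S" if "finite F" "F \<subseteq> A" for F
  proof -
    have "ennreal (sum c F) = (\<Sum>x\<in>F. ennreal (c x))"
      using that nonneg by (subst sum_ennreal) auto
    also have "\<dots> \<le> (\<Sum>\<^sub>\<infinity>x\<in>A. ennreal (c x))"
      using that by (subst nonneg_infsum_complete) (auto intro!: SUP_upper)
    finally show ?thesis
      using S by simp
  qed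
  show summable: "c summable_on A"
    using le nonneg by (intro nonneg_bdd_above_summable_on) (auto simp: bdd_above_def)
  then have abs: "Infinite_Set_Sum.abs_summable_on c A"
    using summable_on_iff_abs_summable_on_real abs_summable_equivalent by blast
  have "(\<integral>\<^sup>+x. ennreal (c x) \<partial>count_space A) = ennreal (infsum c A)"
    using nn_integral_conv_infsetsum[OF abs nonneg] infsetsum_infsum[OF abs] by simp
  also have "\<dots> \<le> ennreal S"
    by (intro ennreal_leI infsum_le_finite_sums summable le)
  finally show "(\<integral>\<^sup>+x. ennreal (c x) \<partial>count_space A) \<le> (\<Sum>\<^sub>\<infinity>x\<in>A. ennreal (c x))"
    using S by simp
qed

text \<open>A colouring of finite total weight is nonzero on countably many sets only, and
  restriction to these changes neither its weight nor its coverage. On a countable index set,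
  counting measure is sigma-finite.\<close>

lemma countable_fractional_colouring:
  assumes "frac_chromatic_number M I < ennreal s"
  obtains K :: "'a set set" and c :: "'a set \<Rightarrow> ennreal"
  where "countable K" "K \<subseteq> I" "(\<integral>\<^sup>+J. c J \<partial>count_space K) < ennreal s"
    "AE x in M. 1 \<le> (\<integral>\<^sup>+J. c J * indicator J x \<partial>count_space K)"
proof -
  obtain c :: "'a set \<Rightarrow> real" where c: "c \<in> I \<rightarrow> {0..1}"
    and s: "(\<Sum>\<^sub>\<infinity>J\<in>I. ennreal (c J)) < ennreal s"
    and cov: "AE x in M. 1 \<le> (\<Sum>\<^sub>\<infinity>J\<in>{J\<in>I. x \<in> J}. ennreal (c J))"
    using assms unfolding frac_chromatic_number_def Inf_less_iff by auto
  have fin: "(\<Sum>\<^sub>\<infinity>J\<in>I. ennreal (c J)) < \<infinity>"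
    using s by (simp add: order_less_trans)
  note sum = summable_on_ennreal_infsum_finite[of I c, OF _ fin]
  define K where "K = {J\<in>I. c J \<noteq> 0}"
  \<comment> \<open>The free factor \<open>g\<close> serves both uses: \<open>g = 1\<close> gives
    the total weight, and indicators give the coverage of a point.\<close>
  have K: "(\<integral>\<^sup>+J. ennreal (c J) * g J \<partial>count_space K) = (\<integral>\<^sup>+J. ennreal (c J) * g J \<partial>count_space I)"
    for g
    by (subst (1 2) nn_integral_count_space_indicator)
      (auto simp: K_def intro!: nn_integral_cong split: split_indicator)
  show ?thesis
  proof (rule that[of K "\<lambda>J. ennreal (c J)"])
    show "countable K"
      unfolding K_def using c by (intro summable_countable_real sum) auto
    have "(\<integral>\<^sup>+J. ennreal (c J) \<partial>count_space K) = (\<integral>\<^sup>+J. ennreal (c J) \<partial>count_space I)"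
      using K[of "\<lambda>_. 1"] by simp
    also have "\<dots> \<le> (\<Sum>\<^sub>\<infinity>J\<in>I. ennreal (c J))"
      using c by (intro sum) auto
    finally show "(\<integral>\<^sup>+J. ennreal (c J) \<partial>count_space K) < ennreal s"
      using s by simp
    have "(\<Sum>\<^sub>\<infinity>J\<in>{J\<in>I. x \<in> J}. ennreal (c J)) \<le> (\<integral>\<^sup>+J. ennreal (c J) * indicator J x \<partial>count_space K)" for x
    proof -
      have "(\<Sum>\<^sub>\<infinity>J\<in>{J\<in>I. x \<in> J}. ennreal (c J)) \<le> (\<integral>\<^sup>+J. ennreal (c J) \<partial>count_space {J\<in>I. x \<in> J})"
        by (rule infsum_le_nn_integral_count_space)
      also have "\<dots> = (\<integral>\<^sup>+J. ennreal (c J) * indicator J x \<partial>count_space I)"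
        by (subst (1 2) nn_integral_count_space_indicator)
          (auto intro!: nn_integral_cong split: split_indicator)
      finally show ?thesis
        using K by simp
    qed
    with cov show "AE x in M. 1 \<le> (\<integral>\<^sup>+J. ennreal (c J) * indicator J x \<partial>count_space K)"
      by (auto intro: order_trans elim!: eventually_mono)
  qed (auto simp: K_def)
qed

section \<open>Greedy covering by boxes\<close>

text \<open>This expands a product of sums into a sum over choice functions: a finite power of
  counting measure on a countable set is counting measure on the functions.\<close>

lemma nn_integral_count_space_PiE_prod:
  fixes f :: "'i \<Rightarrow> 'b \<Rightarrow> ennreal"
  assumes "finite A" "countable K"
  shows "(\<integral>\<^sup>+j. (\<Prod>i\<in>A. f i (j i)) \<partial>count_space (A \<rightarrow>\<^sub>E K)) = (\<Prod>i\<in>A. \<integral>\<^sup>+J. f i J \<partial>count_space K)"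
proof -
  interpret product_sigma_finite "\<lambda>_::'i. count_space K"
    using assms(2) by (intro product_sigma_finite.intro sigma_finite_measure_count_space_countable)
  have "(\<integral>\<^sup>+j. (\<Prod>i\<in>A. f i (j i)) \<partial>(Pi\<^sub>M A (\<lambda>_. count_space K))) = (\<Prod>i\<in>A. \<integral>\<^sup>+J. f i J \<partial>count_space K)"
    using assms(1) by (intro product_nn_integral_prod) auto
  then show ?thesis
    using assms by (simp add: count_space_PiM_finite)
qed

text \<open>The average of \<open>Q (U \<inter> box)\<close> over all boxes with weights \<open>\<Prod>i. c (J i)\<close> is at least
  \<open>Q U / (\<integral> c) ^ l\<close>, since the weighted number of boxes through almost every point is at least 1.\<close>

lemma exists_box_covering_fraction:
  fixes s :: real
  assumes "prob_space P" "I \<subseteq> sets P" "frac_chromatic_number P I < ennreal s" "0 < l"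
    and U: "U \<in> sets (Pi\<^sub>M {..<l} (\<lambda>_. P))" "0 < measure (Pi\<^sub>M {..<l} (\<lambda>_. P)) U"
  shows "\<exists>b\<in>boxes l I. measure (Pi\<^sub>M {..<l} (\<lambda>_. P)) U / s ^ l \<le> measure (Pi\<^sub>M {..<l} (\<lambda>_. P)) (U \<inter> b)"
proof (rule ccontr)
  let ?Q = "Pi\<^sub>M {..<l} (\<lambda>_. P)"
  let ?u = "measure ?Q U"
  assume contra: "\<not> ?thesis"
  interpret Q: prob_space ?Q
    using assms(1) by (rule prob_space_PiM)
  obtain K and c :: "'a set \<Rightarrow> ennreal" where K: "countable K" "K \<subseteq> I"
    and c: "(\<integral>\<^sup>+J. c J \<partial>count_space K) < ennreal s"
    and cov: "AE x in P. 1 \<le> (\<integral>\<^sup>+J. c J * indicator J x \<partial>count_space K)"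
    using countable_fractional_colouring[OF assms(3)] .
  have s: "0 < s"
    using assms(3) by (metis ennreal_eq_0_iff not_gr_zero not_less not_less_zero)
  obtain S where S: "(\<integral>\<^sup>+J. c J \<partial>count_space K) = ennreal S" "0 \<le> S"
    using c by (cases "\<integral>\<^sup>+J. c J \<partial>count_space K") auto
  have "S < s"
    using c S by (simp add: ennreal_less_iff)
  let ?X = "{..<l} \<rightarrow>\<^sub>E K"
  have countX: "countable ?X"
    using K(1) by (intro countable_PiE) auto
  let ?box = "\<lambda>j. \<Pi>\<^sub>E i\<in>{..<l}. j i"
  have box_in: "?box j \<in> boxes l I" if "j \<in> ?X" for j
    using that K(2) unfolding boxes_def by (intro CollectI exI[of _ j]) (auto simp: PiE_iff)
  then have box_sets: "?box j \<in> sets ?Q" if "j \<in> ?X" for j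
    using that boxes_subset_sets_PiM[OF assms(2)] by blast
  have "ennreal ?u = (\<integral>\<^sup>+x. indicator U x \<partial>?Q)"
    using U(1) by (simp add: Q.emeasure_eq_measure)
  \<comment> \<open>Almost every point of \<open>U\<close> lies in boxes of total weight at least
    1.\<close>
  also have "\<dots> \<le> (\<integral>\<^sup>+x. \<integral>\<^sup>+j. (\<Prod>i<l. c (j i)) * indicator (U \<inter> ?box j) x \<partial>count_space ?X \<partial>?Q)"
  proof (rule nn_integral_mono_AE)
    have "AE x in ?Q. \<forall>i\<in>{..<l}. 1 \<le> (\<integral>\<^sup>+J. c J * indicator J (x i) \<partial>count_space K)"
      using assms(1) cov by (intro AE_finite_allI AE_PiM_component) auto
    moreover have "AE x in ?Q. x \<in> space ?Q"
      by (rule AE_space)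
    ultimately show "AE x in ?Q. indicator U x \<le>
        (\<integral>\<^sup>+j. (\<Prod>i<l. c (j i)) * indicator (U \<inter> ?box j) x \<partial>count_space ?X)"
    proof eventually_elim
      case (elim x)
      \<comment> \<open>Each coordinate is covered with weight at least 1; multiplying these sums
        out gives the weight of the boxes through \<open>x\<close>.\<close>
      have "1 \<le> (\<Prod>i<l. \<integral>\<^sup>+J. c J * indicator J (x i) \<partial>count_space K)"
        using elim(1) prod_mono_ennreal[of "{..<l}" "\<lambda>_. 1"] by simp
      also have "\<dots> = (\<integral>\<^sup>+j. (\<Prod>i<l. c (j i) * indicator (j i) (x i)) \<partial>count_space ?X)"
        using K(1) by (intro nn_integral_count_space_PiE_prod[symmetric]) auto
      also have "\<dots> = (\<integral>\<^sup>+j. (\<Prod>i<l. c (j i)) * indicator (?box j) x \<partial>count_space ?X)"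
      proof (intro nn_integral_cong)
        fix j
        have "(\<Prod>i<l. indicator (j i) (x i)) = (indicator (?box j) x :: ennreal)"
        proof (cases "x \<in> ?box j")
          \<comment> \<open>Points of the product space are extensional, so \<open>x\<close> can
            miss the box only at some coordinate below \<open>l\<close>.\<close>
          case False
          then obtain i where "i < l" "x i \<notin> j i"
            using elim(2) by (auto simp: space_PiM PiE_iff)
          then have "(\<Prod>i<l. indicator (j i) (x i)) = (0 :: ennreal)"
            by (intro prod_zero bexI[of _ i]) simp_all
          then show ?thesis
            unfolding indicator_simps(2)[OF False] .
        qed (auto simp: PiE_iff intro!: prod.neutral)
        then show "(\<Prod>i<l. c (j i) * indicator (j i) (x i)) = (\<Prod>i<l. c (j i)) * indicator (?box j) x"
          by (simp add: prod.distrib)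
      qed
      finally show ?case
        by (cases "x \<in> U") (simp_all add: indicator_inter_arith)
    qed
  qed
  also have "\<dots> = (\<integral>\<^sup>+j. \<integral>\<^sup>+x. (\<Prod>i<l. c (j i)) * indicator (U \<inter> ?box j) x \<partial>?Q \<partial>count_space ?X)"
    using U(1) box_sets by (intro nn_integral_count_space_nn_integral countX borel_measurable_times_ennreal
        borel_measurable_const borel_measurable_indicator sets.Int)
  also have "\<dots> = (\<integral>\<^sup>+j. (\<Prod>i<l. c (j i)) * emeasure ?Q (U \<inter> ?box j) \<partial>count_space ?X)"
    using U(1) box_sets by (intro nn_integral_cong nn_integral_cmult_indicator sets.Int) simp_all
  \<comment> \<open>By the assumption for contradiction, every box meets \<open>U\<close> in measure
    below \<open>?u / s ^ l\<close>.\<close>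
  also have "\<dots> \<le> (\<integral>\<^sup>+j. (\<Prod>i<l. c (j i)) * ennreal (?u / s ^ l) \<partial>count_space ?X)"
    using contra box_in
    by (intro nn_integral_mono mult_left_mono) (force simp: Q.emeasure_eq_measure intro!: ennreal_leI)+
  also have "\<dots> = (\<Prod>i<l. \<integral>\<^sup>+J. c J \<partial>count_space K) * ennreal (?u / s ^ l)"
    using K(1) nn_integral_count_space_PiE_prod[of "{..<l}" K "\<lambda>_. c"]
    by (simp add: nn_integral_multc)
  also have "\<dots> = ennreal (S ^ l * (?u / s ^ l))"
    using S by (subst ennreal_mult'') (auto simp: ennreal_power s less_imp_le)
  finally have "?u \<le> S ^ l * (?u / s ^ l)"
    using S s by (simp add: ennreal_le_iff)
  \<comment> \<open>The integral comparison is not strict, so the contradiction comes from the gap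
    between \<open>S\<close> and \<open>s\<close>, which survives the power because \<open>l\<close>
    is positive.\<close>
  moreover have "S ^ l < s ^ l"
    using \<open>S < s\<close> \<open>0 \<le> S\<close> \<open>0 < l\<close> by (intro power_strict_mono) auto
  ultimately show False
    using U(2) s by (simp add: field_simps)
qed

text \<open>Induction on \<open>k\<close>: adding a box that covers the fraction
  \<open>1 / s ^ l\<close> of the remainder multiplies the uncovered measure by at most
  \<open>1 - 1 / s ^ l\<close>, which is nonnegative as \<open>1 \<le> s\<close>.\<close>

lemma exists_boxes_cover:
  fixes s :: real
  assumes "prob_space P" "I \<subseteq> sets P" "frac_chromatic_number P I < ennreal s" "0 < l" "1 \<le> s"
  shows "\<exists>B. finite B \<and> B \<subseteq> boxes l I \<and> card B \<le> k \<and>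
    measure (Pi\<^sub>M {..<l} (\<lambda>_. P)) (space (Pi\<^sub>M {..<l} (\<lambda>_. P)) - \<Union>B) \<le> (1 - 1 / s ^ l) ^ k"
proof (induction k)
  let ?Q = "Pi\<^sub>M {..<l} (\<lambda>_. P)"
  interpret Q: prob_space ?Q
    using assms(1) by (rule prob_space_PiM)
  {
    case 0
    show ?case
      by (intro exI[of _ "{}"]) (simp add: Q.prob_space)
  next
    case (Suc k)
    then obtain B where B: "finite B" "B \<subseteq> boxes l I" "card B \<le> k"
      "measure ?Q (space ?Q - \<Union>B) \<le> (1 - 1 / s ^ l) ^ k"
      by auto
    let ?U = "space ?Q - \<Union>B"
    have nonneg: "0 \<le> 1 - 1 / s ^ l"
      using assms(5) by simp
    have U: "?U \<in> sets ?Q"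
      using B(1,2) boxes_subset_sets_PiM[OF assms(2)]
      by (intro sets.Diff sets.top sets.finite_Union) auto
    show ?case
    proof (cases "measure ?Q ?U = 0")
      \<comment> \<open>Once the remainder is null no box is added, so \<open>card B\<close> is only
        bounded by \<open>k\<close>.\<close>
      case True
      with B nonneg show ?thesis
        by (intro exI[of _ B]) auto
    next
      case False
      then obtain b where b: "b \<in> boxes l I" "measure ?Q ?U / s ^ l \<le> measure ?Q (?U \<inter> b)"
        using exists_box_covering_fraction[OF assms(1-4) U] by (auto simp: zero_less_measure_iff)
      have "b \<in> sets ?Q"
        using b(1) boxes_subset_sets_PiM[OF assms(2)] by auto
      have "space ?Q - \<Union>(insert b B) = ?U - (?U \<inter> b)"
        by auto
      then have "measure ?Q (space ?Q - \<Union>(insert b B)) = measure ?Q ?U - measure ?Q (?U \<inter> b)"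
        using U \<open>b \<in> sets ?Q\<close> by (simp only:) (intro Q.finite_measure_Diff, auto)
      also have "\<dots> \<le> measure ?Q ?U * (1 - 1 / s ^ l)"
        using b(2) by (simp add: algebra_simps)
      also have "\<dots> \<le> (1 - 1 / s ^ l) ^ k * (1 - 1 / s ^ l)"
        using B(4) nonneg by (rule mult_right_mono)
      finally have "measure ?Q (space ?Q - \<Union>(insert b B)) \<le> (1 - 1 / s ^ l) ^ Suc k"
        by (simp add: mult.commute)
      moreover have "card (insert b B) \<le> Suc k"
        using B(1,3) by (simp add: card_insert_if)
      ultimately show ?thesis
        using B b(1) by (intro exI[of _ "insert b B"]) auto
    qed
  }
qed

section \<open>The upper bound from fractional colourings\<close>

text \<open>By \<open>1 - x \<le> exp (- x)\<close>, taking \<open>k\<close> at least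
  \<open>s ^ l * ln (1 / lam)\<close> leaves at most \<open>lam\<close> uncovered. Rounding up adds
  at most 1, which \<open>s ^ l\<close> absorbs; hence the \<open>+ 1\<close> in the
  constant.\<close>

lemma box_number_le:
  fixes s :: real
  assumes "prob_space P" "I \<subseteq> sets P" "frac_chromatic_number P I < ennreal s" "0 < l" "1 \<le> s"
    and "0 < lam" "lam < 1"
  shows "ennreal_of_enat (box_number l I P lam) \<le> ennreal (s ^ l * (ln (1 / lam) + 1))"
proof -
  let ?Q = "Pi\<^sub>M {..<l} (\<lambda>_. P)"
  interpret Q: prob_space ?Q
    using assms(1) by (rule prob_space_PiM)
  define L where "L = ln (1 / lam)"
  have "0 < L"
    using assms by (simp add: L_def)
  have sl: "1 \<le> s ^ l"
    using assms(5) by (rule one_le_power)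
  define k where "k = nat \<lceil>s ^ l * L\<rceil>"
  have k: "s ^ l * L \<le> real k" "real k \<le> s ^ l * L + 1"
    unfolding k_def using \<open>0 < L\<close> sl by (simp_all add: real_nat_ceiling_ge)
  obtain B where B: "finite B" "B \<subseteq> boxes l I" "card B \<le> k"
    "measure ?Q (space ?Q - \<Union>B) \<le> (1 - 1 / s ^ l) ^ k"
    using exists_boxes_cover[OF assms(1-5)] by blast
  have "(1 - 1 / s ^ l) ^ k \<le> exp (- (1 / s ^ l)) ^ k"
    using sl exp_ge_add_one_self[of "- (1 / s ^ l)"] by (intro power_mono) auto
  also have "\<dots> = exp (- (real k / s ^ l))"
    by (simp add: exp_of_nat_mult[symmetric])
  also have "\<dots> \<le> exp (- L)"
    using k(1) sl by (simp add: field_simps)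
  also have "\<dots> = lam"
    using assms by (simp add: L_def ln_div)
  finally have "1 - lam \<le> 1 - measure ?Q (space ?Q - \<Union>B)"
    using B(4) by linarith
  also have "\<dots> = measure ?Q (\<Union>B)"
    using B(1,2) boxes_subset_sets_PiM[OF assms(2)]
    by (subst Q.prob_compl[of "\<Union>B"]) (auto intro!: sets.finite_Union)
  finally have "box_number l I P lam \<le> enat (card B)"
    unfolding box_number_def using B by (intro Inf_lower) auto
  also have "\<dots> \<le> enat k"
    using B(3) by simp
  finally have "ennreal_of_enat (box_number l I P lam) \<le> ennreal_of_enat (enat k)"
    by (simp only: ennreal_of_enat_le_iff)
  also have "\<dots> = ennreal (real k)"
    by (simp add: ennreal_of_nat_eq_real_of_nat)
  also have "real k \<le> s ^ l * (L + 1)"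
    using k(2) sl by (simp add: algebra_simps)
  finally show ?thesis
    unfolding L_def by (simp add: ennreal_leI)
qed

text \<open>The factor \<open>ln (1 / lam) + 1\<close> is positive and independent of
  \<open>l\<close>, so its logarithm divided by \<open>l\<close> tends to 0.\<close>

lemma H_upper_le_ln:
  fixes s :: real
  assumes "prob_space P" "I \<subseteq> sets P" "frac_chromatic_number P I < ennreal s" "1 \<le> s"
    and "0 < lam" "lam < 1"
  shows "H_upper lam I P \<le> ereal (ln s)"
proof -
  have C: "0 < ln (1 / lam) + 1"
    using assms by (simp add: add_pos_pos)
  let ?f = "\<lambda>l. ln s + ln (ln (1 / lam) + 1) * inverse (real l)"
  have "H_upper lam I P \<le> limsup (\<lambda>l. ereal (?f l))"
    unfolding H_upper_def
  proof (rule Limsup_mono, rule eventually_sequentiallyI[of 1])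
    fix l :: nat assume "1 \<le> l"
    have "ereal (1 / real l) * elog (ennreal_of_enat (box_number l I P lam))
        \<le> ereal (1 / real l) * elog (ennreal (s ^ l * (ln (1 / lam) + 1)))"
      using \<open>1 \<le> l\<close> by (intro ereal_mult_left_mono elog_mono box_number_le assms) auto
    also have "\<dots> = ereal (1 / real l * ln (s ^ l * (ln (1 / lam) + 1)))"
      using assms(4) C by (subst elog_ennreal) auto
    also have "ln (s ^ l * (ln (1 / lam) + 1)) = real l * ln s + ln (ln (1 / lam) + 1)"
      using assms(4) C by (subst ln_mult) (auto simp: ln_realpow)
    also have "1 / real l * (real l * ln s + ln (ln (1 / lam) + 1)) = ?f l"
      using \<open>1 \<le> l\<close> by (simp add: field_simps)
    finally show "ereal (1 / real l) * elog (ennreal_of_enat (box_number l I P lam)) \<le> ereal (?f l)" .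
  qed
  also have "?f \<longlonglongrightarrow> ln s + ln (ln (1 / lam) + 1) * 0"
    by (intro tendsto_intros lim_inverse_n)
  then have "(\<lambda>l. ereal (?f l)) \<longlonglongrightarrow> ereal (ln s)"
    by simp
  then have "limsup (\<lambda>l. ereal (?f l)) = ereal (ln s)"
    by (intro lim_imp_Limsup sequentially_bot)
  finally show ?thesis .
qed

section \<open>Comparison with the reference measure and conclusion\<close>

text \<open>Null sets of \<open>M\<close> are null for \<open>P\<close>, so each fractional
  colouring for \<open>M\<close> is one for \<open>P\<close>, of the same weight.\<close>

lemma frac_chromatic_number_ac_le:
  assumes "P \<in> ac_prob_measures M"
  shows "frac_chromatic_number P I \<le> frac_chromatic_number M I"
  unfolding frac_chromatic_number_def
  using assms by (intro Inf_superset_mono) (auto simp: ac_prob_measures_def intro!: absolutely_continuous_AE[of P M])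

text \<open>The constant weight 1 is admissible. When clique and chromatic numbers agree, this puts
  the chromatic number at 1 or above, as the greedy bound requires.\<close>

lemma one_le_frac_clique_number:
  assumes "prob_space M" "I \<subseteq> sets M" "1 \<in> R"
  shows "1 \<le> frac_clique_number R M I"
proof -
  interpret prob_space M by fact
  have "(\<integral>\<^sup>+x. ennreal ((\<lambda>_. 1) x) \<partial>M) \<le> frac_clique_number R M I"
    unfolding frac_clique_number_def
  proof (intro Sup_upper CollectI exI[of _ "\<lambda>_. 1"] conjI refl ballI)
    fix J assume "J \<in> I"
    with assms(2) show "(\<integral>\<^sup>+x\<in>J. ennreal 1 \<partial>M) \<le> 1"
      by (auto simp: emeasure_le_1)
  qed (use assms(3) in auto)
  then show ?thesis
    by (simp add: emeasure_space_1)
qed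

text \<open>Apply the bound \<open>ln s\<close> with \<open>s = exp r\<close> for every real
  \<open>r\<close> above the right-hand side. If the chromatic number is infinite, there is nothing
  to show.\<close>

lemma H_upper_le_elog_frac_chromatic_number:
  assumes "P \<in> ac_prob_measures M" "I \<subseteq> sets M" "1 \<le> frac_chromatic_number M I"
    and "0 < lam" "lam < 1"
  shows "H_upper lam I P \<le> elog (frac_chromatic_number M I)"
proof (rule dense_ge)
  fix z assume z: "elog (frac_chromatic_number M I) < z"
  show "H_upper lam I P \<le> z"
  proof (cases z)
    case (real r)
    with z have chi: "frac_chromatic_number M I < ennreal (exp r)"
      by (simp add: elog_less_ereal_iff)
    with assms(3) have "1 < ennreal (exp r)"
      by (rule le_less_trans)
    then have "1 \<le> exp r"
      by (simp add: ennreal_less_iff flip: ennreal_1)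
    moreover have "frac_chromatic_number P I < ennreal (exp r)"
      using frac_chromatic_number_ac_le[OF assms(1)] chi by (rule le_less_trans)
    ultimately have "H_upper lam I P \<le> ereal (ln (exp r))"
      using assms by (intro H_upper_le_ln) (auto simp: ac_prob_measures_def)
    with real show ?thesis
      by simp
  qed (use z in auto)
qed

theorem theorem5p5:
  fixes M :: "'a measure" and I :: "'a set set" and lam :: real
  assumes "prob_space M"
    and "I \<subseteq> sets M"
    and "frac_clique_number {0..1} M I = frac_chromatic_number M I \<or>
         frac_clique_number {0..} M I = frac_chromatic_number M I"
    and "0 < lam" and "lam < 1"
  shows "(SUP P\<in>ac_prob_measures M. H_lower lam I P) = elog (frac_chromatic_number M I) \<and>
         (SUP P\<in>ac_prob_measures M. H_upper lam I P) = elog (frac_chromatic_number M I)"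
proof -
  \<comment> \<open>Both weight ranges contain 1, so a single argument treats the two
    normalisations.\<close>
  obtain R where R: "1 \<in> R" "frac_clique_number R M I = frac_chromatic_number M I"
    using assms(3) by (metis atLeastAtMost_iff atLeast_iff order_refl zero_le_one)
  have "elog (frac_chromatic_number M I) \<le> (SUP P\<in>ac_prob_measures M. H_lower lam I P)"
    using elog_frac_clique_number_le[OF assms(1,2,5), of R] R(2) by simp
  moreover have "(SUP P\<in>ac_prob_measures M. H_lower lam I P) \<le> (SUP P\<in>ac_prob_measures M. H_upper lam I P)"
    by (intro SUP_mono') (rule H_lower_le_H_upper)
  moreover have "1 \<le> frac_chromatic_number M I"
    using one_le_frac_clique_number[OF assms(1,2) R(1)] R(2) by simp
  then have "(SUP P\<in>ac_prob_measures M. H_upper lam I P) \<le> elog (frac_chromatic_number M I)"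
    using assms by (intro SUP_least H_upper_le_elog_frac_chromatic_number)
  ultimately show ?thesis
    \<comment> \<open>The inequalities form a cycle from the chromatic number through the lower and
      upper suprema back to it, so all are equalities.\<close>
    by (meson antisym order_trans)
qed

end
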